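(* Let $n\geq 2$, let $q$ be a prime power, let $F=\mathbb{F}_q$, and let $t\in F$. If $(q,n,t)\neq(2,2,1)$, then there exist conjugacy classes $X,Y\subset M_n(F)$ such that the characteristic polynomial of $X$ is irreducible of degree $n$ over $F$, the characteristic polynomial of $Y$ is $(T-\lambda)h(T)$ for some $\lambda\in F$ and some irreducible $h(T)\in F[T]$ of degree $n-1$ with $h(\lambda)\neq 0$ (so when $n=2$ the two linear factors are distinct), and $\mathrm{Tr}(X)+\mathrm{Tr}(Y)=t$. Moreover, the case $(q,n,t)=(2,2,1)$ is a genuine exception: for $q=n=2$ and $t=1$ no such pair $X,Y$ exists.
   Context: A conjugacy class in $M_n(F)$ is an orbit of $M_n(F)$ under conjugation by $\mathrm{GL}_n(F)$; its characteristic polynomial and trace $\mathrm{Tr}(X)$ are those of any of its elements. *)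

theory Defs
  imports "HOL-Number_Theory.Prime_Powers" "Jordan_Normal_Form.Char_Poly"
begin

definition conj_class :: "nat \<Rightarrow> 'a::field mat \<Rightarrow> 'a mat set" where
  "conj_class n A = {P * A * Q | P Q. P \<in> carrier_mat n n \<and> Q \<in> carrier_mat n n
                                      \<and> P * Q = 1\<^sub>m n \<and> Q * P = 1\<^sub>m n}"

definition conj_classes :: "nat \<Rightarrow> 'a::field mat set set" where
  "conj_classes n = conj_class n ` carrier_mat n n"

definition mat_trace :: "'a::comm_ring_1 mat \<Rightarrow> 'a" where
  "mat_trace A = (\<Sum>i<dim_row A. A $$ (i, i))"

text \<open>The characteristic polynomial and the trace of a conjugacy class are the common values
  taken on its elements; the lemmas \<open>class_char_poly_eq\<close> and \<open>class_trace_eq\<close> below show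
  that these common values exist.\<close>

definition class_char_poly :: "'a::field mat set \<Rightarrow> 'a poly" where
  "class_char_poly X = (THE p. \<forall>A\<in>X. char_poly A = p)"

definition class_trace :: "'a::field mat set \<Rightarrow> 'a" where
  "class_trace X = (THE s. \<forall>A\<in>X. mat_trace A = s)"

lemma conj_class_eq_similar:
  assumes "A \<in> carrier_mat n n"
  shows "conj_class n A = {B. similar_mat B A}"
proof (intro Set.set_eqI iffI)
  fix B assume "B \<in> conj_class n A"
  then obtain P Q where "P \<in> carrier_mat n n" "Q \<in> carrier_mat n n"
    "P * Q = 1\<^sub>m n" "Q * P = 1\<^sub>m n" "B = P * A * Q"
    by (auto simp: conj_class_def)
  with assms show "B \<in> {B. similar_mat B A}"
    by (auto intro!: similar_matI[of _ _ P Q n])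
next
  fix B assume "B \<in> {B. similar_mat B A}"
  then obtain m P Q where *: "{B, A, P, Q} \<subseteq> carrier_mat m m"
    "P * Q = 1\<^sub>m m" "Q * P = 1\<^sub>m m" "B = P * A * Q"
    by (auto dest!: similar_matD)
  with assms have "m = n" by auto
  with * show "B \<in> conj_class n A"
    by (auto simp: conj_class_def)
qed

lemma mat_trace_comm:
  assumes "A \<in> carrier_mat n m" "B \<in> carrier_mat m n"
  shows "mat_trace (A * B) = mat_trace (B * A)"
proof -
  have "mat_trace (A * B) = (\<Sum>i<n. \<Sum>j<m. A $$ (i, j) * B $$ (j, i))"
    using assms by (auto simp: mat_trace_def scalar_prod_def atLeast0LessThan intro!: sum.cong)
  also have "\<dots> = (\<Sum>j<m. \<Sum>i<n. B $$ (j, i) * A $$ (i, j))"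
    by (subst sum.swap) (simp add: mult.commute)
  also have "\<dots> = mat_trace (B * A)"
    using assms by (auto simp: mat_trace_def scalar_prod_def atLeast0LessThan intro!: sum.cong)
  finally show ?thesis .
qed

lemma mat_trace_similar:
  assumes "similar_mat A B"
  shows "mat_trace A = mat_trace B"
proof -
  from similar_matD[OF assms] obtain n P Q where
    *: "A \<in> carrier_mat n n" "B \<in> carrier_mat n n" "P \<in> carrier_mat n n" "Q \<in> carrier_mat n n"
    and PQ: "Q * P = 1\<^sub>m n" and A: "A = P * B * Q"
    by auto
  have "mat_trace A = mat_trace (Q * (P * B))"
    unfolding A using * by (intro mat_trace_comm[of _ n n]) auto
  also have "Q * (P * B) = Q * P * B"
    using * by (simp add: assoc_mult_mat[of _ n n _ n _ n])
  also have "\<dots> = B"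
    using * PQ by simp
  finally show ?thesis .
qed

lemma conj_classes_similar:
  assumes "X \<in> conj_classes n" "A \<in> X" "B \<in> X"
  shows "similar_mat B A"
  using assms unfolding conj_classes_def
  by (auto simp: conj_class_eq_similar dest: similar_mat_sym intro: similar_mat_trans)

lemma class_char_poly_eq:
  assumes "X \<in> conj_classes n" "A \<in> X"
  shows "class_char_poly X = char_poly A"
  unfolding class_char_poly_def
  by (rule the_equality) (use assms in \<open>auto dest: conj_classes_similar char_poly_similar\<close>)

lemma class_trace_eq:
  assumes "X \<in> conj_classes n" "A \<in> X"
  shows "class_trace X = mat_trace A"
  unfolding class_trace_def
  by (rule the_equality) (use assms in \<open>auto dest: conj_classes_similar mat_trace_similar\<close>)

end

theory Submission
  imports Defs "HOL-Library.Cardinality"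
begin

text \<open>Companion matrices reduce the claim to polynomials: one needs monic irreducible \<open>f\<close> and \<open>h\<close>
  of degrees \<open>n\<close> and \<open>n - 1\<close> over \<open>F\<close> and \<open>l\<close> in \<open>F\<close> with \<open>h(l) \<noteq> 0\<close> such that \<open>l\<close> and
  the traces of \<open>f\<close> and \<open>h\<close> (sums of roots) add up to \<open>t\<close>.
  Irreducible polynomials of every degree exist by Gauss' count: comparing, over all monic \<open>f\<close> of
  degree \<open>n\<close>, the degree of \<open>f\<close> with the sum of \<open>deg p\<close> over all prime powers \<open>p\<^sup>k\<close> dividing \<open>f\<close> shows
  that the prime powers of degree \<open>n\<close>, weighted by \<open>deg p\<close>, number \<open>q\<^sup>n\<close>; if no prime had degree \<open>n\<close>,
  this would be at most \<open>q + \<dots> + q\<^sup>n\<^sup>-\<^sup>1 < q\<^sup>n\<close>. For \<open>n \<ge> 3\<close> the polynomial \<open>h\<close> has no root, so \<open>l\<close> is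
  free and absorbs \<open>t\<close>. For \<open>n = 2\<close> one has to write a given element as a sum of two distinct ones,
  which fails only for \<open>0\<close> in characteristic two; there an irreducible quadratic has nonzero trace,
  and scaling its roots changes that trace unless \<open>q = 2\<close>.\<close>

section \<open>Counting prime powers\<close>

definition monics :: "nat \<Rightarrow> 'a :: field poly set" where
  "monics n = {f. monic f \<and> degree f = n}"

text \<open>Pairs stand for the powers \<open>p ^ k\<close>: the weight \<open>degree p\<close> can
  be read off a pair without recovering \<open>p\<close> from the power.\<close>

definition prime_powers :: "('a :: field poly \<times> nat) set" where
  "prime_powers = {(p, k). monic p \<and> irreducible p \<and> 0 < k}"

definition prime_powers_of_degree :: "nat \<Rightarrow> ('a :: field poly \<times> nat) set" where
  "prime_powers_of_degree n = {(p, k) \<in> prime_powers. k * degree p = n}"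

section \<open>Monic polynomials of a given degree\<close>

lemma monics_0: "monics 0 = {1}"
  by (auto simp: monics_def elim!: degree_eq_zeroE)

text \<open>The constant coefficient is free, so each further degree multiplies the count by the
  size of the field.\<close>

lemma bij_betw_pCons_monics:
  "bij_betw (\<lambda>(a, f :: 'a :: field poly). pCons a f) (UNIV \<times> monics n) (monics (Suc n))"
proof (rule bij_betw_imageI)
  show "(\<lambda>(a, f). pCons a f) ` (UNIV \<times> monics n) = (monics (Suc n) :: 'a poly set)"
  proof (intro equalityI subsetI)
    fix f :: "'a poly" assume f: "f \<in> monics (Suc n)"
    obtain a g where g: "f = pCons a g" by (cases f)
    then have "g \<in> monics n" using f by (auto simp: monics_def split: if_splits)
    then show "f \<in> (\<lambda>(a, f). pCons a f) ` (UNIV \<times> monics n)"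
      using g by (intro image_eqI[of _ _ "(a, g)"]) auto
  qed (auto simp: monics_def)
qed (auto simp: inj_on_def)

lemma
  fixes n :: nat
  shows finite_monics: "finite (monics n :: 'a :: {field, finite} poly set)"
    and card_monics: "card (monics n :: 'a poly set) = CARD('a) ^ n"
proof (induction n)
  case (Suc n)
  { case 1 show ?case
      using Suc(1) by (simp flip: bij_betw_finite[OF bij_betw_pCons_monics])
  next
    case 2 show ?case
      using bij_betw_same_card[OF bij_betw_pCons_monics[where 'a = 'a and n = n]] Suc
      by (simp add: card_cartesian_product) }
qed (simp_all add: monics_0)

text \<open>Multiplication by \<open>g\<close> is a bijection from the monic polynomials of degree
  \<open>n - degree g\<close> onto these multiples.\<close>

lemma card_monics_multiples:
  fixes g :: "'a :: {field, finite} poly"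
  assumes "monic g" "degree g \<le> n"
  shows "card {f \<in> monics n. g dvd f} = CARD('a) ^ (n - degree g)"
proof -
  have "g \<noteq> 0" using assms(1) by auto
  have "{f \<in> monics n. g dvd f} = (*) g ` monics (n - degree g)"
  proof (intro equalityI subsetI)
    fix f assume "f \<in> {f \<in> monics n. g dvd f}"
    then have "g dvd f" and f: "monic f" "degree f = n" by (auto simp: monics_def)
    then obtain h where "f = g * h" by (elim dvdE)
    note h = this f
    have "monic h" using h assms(1) by (metis monic_factor)
    moreover from this have "h \<noteq> 0" by auto
    then have "degree h = n - degree g"
      using h \<open>g \<noteq> 0\<close> by (auto simp: degree_mult_eq)
    ultimately show "f \<in> (*) g ` monics (n - degree g)"
      using h by (auto simp: monics_def)
  next
    fix f assume "f \<in> (*) g ` monics (n - degree g)"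
    then obtain h where "f = g * h" "h \<in> monics (n - degree g)" by (elim imageE)
    then have h: "f = g * h" "monic h" "degree h = n - degree g" by (auto simp: monics_def)
    then have "h \<noteq> 0" by auto
    then show "f \<in> {f \<in> monics n. g dvd f}"
      using h assms \<open>g \<noteq> 0\<close> monic_mult[of g h] by (auto simp: monics_def degree_mult_eq)
  qed
  moreover have "inj_on ((*) g) (monics (n - degree g))"
    using \<open>g \<noteq> 0\<close> by (auto intro: inj_onI)
  ultimately show ?thesis by (simp add: card_image card_monics)
qed

section \<open>Prime power divisors of a monic polynomial\<close>

lemma monic_irreducible_dvd_eq:
  fixes p r :: "'a :: field poly"
  assumes "monic p" "irreducible p" "monic r" "irreducible r" "p dvd r"
  shows "p = r"
proof -
  have "r dvd p" 
    using assms(2,4,5) by (metis irreducible_altdef)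
  with assms show ?thesis by (intro poly_dvd_antisym) auto
qed

text \<open>Peeling off a factor \<open>r\<close> of \<open>f = r * g\<close> shifts the exponents of \<open>r\<close> by one and leaves the
  other prime powers alone.\<close>
lemma prime_power_divisors_mult:
  fixes r g :: "'a :: field poly"
  assumes "monic r" "irreducible r"
  shows "{(p, k) \<in> prime_powers. p ^ k dvd r * g} =
    insert (r, 1) ((\<lambda>(p, k). (p, if p = r then Suc k else k)) ` {(p, k) \<in> prime_powers. p ^ k dvd g})"
    (is "?L = insert _ (?s ` ?R)")
proof (intro equalityI subsetI)
  fix x assume "x \<in> ?L"
  then obtain p k where x: "x = (p, k)" "monic p" "irreducible p" "k > 0" "p ^ k dvd r * g"
    by (auto simp: prime_powers_def)
  show "x \<in> insert (r, 1) (?s ` ?R)"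
  proof (cases "p = r")
    case True
    obtain j where j: "k = Suc j" using x(4) by (cases k) auto
    have "r \<noteq> 0" using assms(1) by auto
    then have "r ^ j dvd g" using x(5) True j by simp
    show ?thesis
    proof (cases "j = 0")
      case False
      then have "(r, j) \<in> ?R" using \<open>r ^ j dvd g\<close> assms by (simp add: prime_powers_def)
      then have "?s (r, j) \<in> ?s ` ?R" by (rule imageI)
      then show ?thesis using x(1) True j by simp
    qed (use x True j in simp)
  next
    case False
    then have "\<not> p dvd r" using monic_irreducible_dvd_eq x assms by blast
    then have "p ^ k dvd g"
      using prime_power_dvd_multD[OF field_poly_irreducible_imp_prime] x by blast
    then have "(p, k) \<in> ?R" using x by (simp add: prime_powers_def)
    then have "?s (p, k) \<in> ?s ` ?R" by (rule imageI)
    then show ?thesis using x(1) False by simp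
  qed
next
  fix x assume "x \<in> insert (r, 1) (?s ` ?R)"
  then show "x \<in> ?L"
    using assms by (auto simp: prime_powers_def)
qed

text \<open>An irreducible \<open>p\<close> of multiplicity \<open>e\<close> in \<open>f\<close>
  contributes the pairs \<open>(p, 1)\<close> to \<open>(p, e)\<close>, hence
  \<open>e * degree p\<close> in total. The induction peels off one irreducible factor at a
  time.\<close>

lemma
  fixes f :: "'a :: field poly"
  assumes "monic f"
  shows finite_prime_power_divisors: "finite {(p, k) \<in> prime_powers. p ^ k dvd f}"
    and sum_degree_prime_power_divisors:
      "(\<Sum>(p, k) \<in> {(p, k) \<in> prime_powers. p ^ k dvd f}. degree p) = degree f"
proof -
  let ?D = "\<lambda>f :: 'a poly. {(p, k) \<in> prime_powers. p ^ k dvd f}"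
  have "finite (?D f) \<and> (\<Sum>(p, k) \<in> ?D f. degree p) = degree f"
    using assms
  proof (induction "degree f" arbitrary: f rule: less_induct)
    case less
    show ?case
    proof (cases "degree f = 0")
      case True
      then have "f = 1" using less.prems by (auto elim!: degree_eq_zeroE)
      have D: "?D f = {}"
        by (auto simp: \<open>f = 1\<close> prime_powers_def is_unit_power_iff simp del: is_unit_field_poly)
      show ?thesis unfolding D using True by simp
    next
      case False
      then obtain r g where r: "irreducible r" "monic r" and f: "f = r * g"
        using irreducible_monic_factor[of f] by auto
      have "monic g" using f r less.prems by (metis monic_factor)
      then have "r \<noteq> 0" "g \<noteq> 0" using r by auto
      then have deg: "degree f = degree r + degree g" by (simp add: f degree_mult_eq)
      have "degree r > 0" using r by auto
      then have IH: "finite (?D g)" "(\<Sum>(p, k) \<in> ?D g. degree p) = degree g"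
        using less.hyps[of g] deg \<open>monic g\<close> by auto
      let ?s = "\<lambda>(p, k). (p, if p = r then Suc k else k)"
      have D: "?D f = insert (r, 1) (?s ` ?D g)"
        unfolding f by (rule prime_power_divisors_mult) (use r in auto)
      \<comment> \<open>Exponents are positive, so after the shift those of \<open>r\<close> are at
        least two.\<close>
      have notin: "(r, 1) \<notin> ?s ` ?D g"
        by (auto simp: prime_powers_def split: if_splits)
      have inj: "inj_on ?s (?D g)"
        by (auto simp: inj_on_def split: if_splits)
      have "(\<Sum>(p, k) \<in> ?D f. degree p) = degree r + (\<Sum>(p, k) \<in> ?s ` ?D g. degree p)"
        unfolding D using notin IH(1) by (subst sum.insert) auto
      also have "(\<Sum>(p, k) \<in> ?s ` ?D g. degree p) = (\<Sum>(p, k) \<in> ?D g. degree p)"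
        using inj by (subst sum.reindex) (auto intro!: sum.cong)
      finally show ?thesis using D IH deg by simp
    qed
  qed
  then show "finite (?D f)" "(\<Sum>(p, k) \<in> ?D f. degree p) = degree f" by auto
qed

section \<open>Gauss' count of prime powers by degree\<close>

lemma finite_prime_powers_of_degree:
  assumes "n > 0"
  shows "finite (prime_powers_of_degree n :: ('a :: {field, finite} poly \<times> nat) set)"
proof (rule finite_subset)
  show "finite ((\<Union>m\<le>n. monics m :: 'a poly set) \<times> {..n})"
    by (intro finite_cartesian_product finite_UN_I finite_monics) auto
  show "(prime_powers_of_degree n :: ('a poly \<times> nat) set) \<subseteq> (\<Union>m\<le>n. monics m) \<times> {..n}"
    using assms by (auto simp: prime_powers_of_degree_def prime_powers_def monics_def)
qed

lemma disjoint_prime_powers_of_degree: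
  "i \<noteq> j \<Longrightarrow> prime_powers_of_degree i \<inter> prime_powers_of_degree j = {}"
  by (auto simp: prime_powers_of_degree_def)

text \<open>Double counting of the pairs of a monic \<open>f\<close> of degree \<open>n\<close> and
  a prime power dividing it, weighted by \<open>degree p\<close>: each \<open>f\<close> contributes
  \<open>n\<close>, and each prime power of degree \<open>m\<close> divides
  \<open>CARD('a) ^ (n - m)\<close> of the \<open>f\<close>.\<close>

lemma sum_convolution_prime_powers:
  "(\<Sum>m=1..n. CARD('a) ^ (n - m) * (\<Sum>(p, k) \<in> (prime_powers_of_degree m :: ('a poly \<times> nat) set). degree p))
     = n * CARD('a :: {field, finite}) ^ n"
proof -
  let ?E = "prime_powers_of_degree :: nat \<Rightarrow> ('a poly \<times> nat) set"
  have fin: "finite (\<Union>m\<in>{1..n}. ?E m)"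
    by (intro finite_UN_I finite_prime_powers_of_degree) auto
  have dvd: "{x \<in> (\<Union>m\<in>{1..n}. ?E m). fst x ^ snd x dvd f} = {(p, k) \<in> prime_powers. p ^ k dvd f}"
    (is "?L = ?R") if f: "f \<in> monics n" for f
  proof (intro equalityI subsetI)
    fix x assume "x \<in> ?R"
    then obtain p k where x: "x = (p, k)" "(p, k) \<in> prime_powers" "p ^ k dvd f" by auto
    then have p: "degree p > 0" "p \<noteq> 0" "k > 0" by (auto simp: prime_powers_def)
    have "f \<noteq> 0" using f by (auto simp: monics_def)
    then have "k * degree p \<le> n"
      using dvd_imp_degree_le[OF x(3)] p f by (simp add: monics_def degree_power_eq mult.commute)
    then show "x \<in> ?L"
      using x p by (auto simp: prime_powers_of_degree_def Suc_le_eq)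
  qed (auto simp: prime_powers_of_degree_def)
  have card: "card {f \<in> monics n. fst x ^ snd x dvd f} = CARD('a) ^ (n - m)"
    if "x \<in> ?E m" "m \<in> {1..n}" for m x
  proof -
    have "degree (fst x ^ snd x) = m" "monic (fst x ^ snd x)"
      using that by (auto simp: prime_powers_of_degree_def prime_powers_def degree_power_eq monic_power)
    then show ?thesis using card_monics_multiples[of "fst x ^ snd x" n] that by simp
  qed
  have "n * CARD('a) ^ n = (\<Sum>f\<in>(monics n :: 'a poly set). degree f)"
    by (simp add: monics_def[symmetric] card_monics[symmetric] mult.commute) 
       (simp add: monics_def)
  also have "\<dots> = (\<Sum>f\<in>monics n. \<Sum>x\<in>{x \<in> (\<Union>m\<in>{1..n}. ?E m). fst x ^ snd x dvd f}. degree (fst x))"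
  proof (intro sum.cong refl)
    fix f :: "'a poly" assume f: "f \<in> monics n"
    then have "monic f" "degree f = n" by (auto simp: monics_def)
    then show "degree f = (\<Sum>x\<in>{x \<in> (\<Union>m\<in>{1..n}. ?E m). fst x ^ snd x dvd f}. degree (fst x))"
      unfolding dvd[OF f] using sum_degree_prime_power_divisors[of f]
      by (simp add: case_prod_unfold)
  qed
  also have "\<dots> = (\<Sum>x\<in>(\<Union>m\<in>{1..n}. ?E m). \<Sum>f\<in>{f \<in> monics n. fst x ^ snd x dvd f}. degree (fst x))"
    by (rule sum.swap_restrict[OF finite_monics fin])
  also have "\<dots> = (\<Sum>m=1..n. \<Sum>x\<in>?E m. \<Sum>f\<in>{f \<in> monics n. fst x ^ snd x dvd f}. degree (fst x))"
    by (rule sum.UNION_disjoint)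
       (auto simp: finite_prime_powers_of_degree disjoint_prime_powers_of_degree)
  also have "\<dots> = (\<Sum>m=1..n. CARD('a) ^ (n - m) * (\<Sum>x\<in>?E m. degree (fst x)))"
    by (intro sum.cong refl) (simp add: card sum_distrib_left)
  finally show ?thesis by (simp add: case_prod_unfold)
qed

text \<open>Subtracting \<open>q\<close> times the convolution identity for \<open>n - 1\<close>
  from the one for \<open>n\<close> leaves only the last summand, and
  \<open>n * q ^ n - q * ((n - 1) * q ^ (n - 1)) = q ^ n\<close>.\<close>

lemma sum_degree_prime_powers_of_degree:
  assumes "n > 0"
  shows "(\<Sum>(p, k) \<in> (prime_powers_of_degree n :: ('a poly \<times> nat) set). degree p) = CARD('a :: {field, finite}) ^ n"
    (is "?S n = _")
proof -
  let ?q = "CARD('a)"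
  obtain m where n: "n = Suc m" using assms by (cases n) auto
  have "n * ?q ^ n = (\<Sum>i=1..n. ?q ^ (n - i) * ?S i)"
    by (rule sum_convolution_prime_powers[symmetric])
  also have "\<dots> = (\<Sum>i=1..m. ?q ^ (n - i) * ?S i) + ?S n"
    by (simp add: n)
  also have "(\<Sum>i=1..m. ?q ^ (n - i) * ?S i) = ?q * (\<Sum>i=1..m. ?q ^ (m - i) * ?S i)"
    unfolding sum_distrib_left by (intro sum.cong refl) (simp add: n Suc_diff_le)
  also have "\<dots> = ?q * (m * ?q ^ m)"
    by (simp only: sum_convolution_prime_powers)
  finally show ?thesis by (simp add: n)
qed

lemma sum_powers_less:
  fixes q :: nat
  assumes "q \<ge> 2" "n > 0"
  shows "(\<Sum>i=1..<n. q ^ i) < q ^ n"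
  using assms(2)
proof (induction n rule: nat_induct_non_zero)
  case (Suc n)
  have "(\<Sum>i=1..<Suc n. q ^ i) < 2 * q ^ n" using Suc by simp
  also have "\<dots> \<le> q ^ Suc n" using assms by simp
  finally show ?case .
qed (use assms in simp)

lemma card_field_ge_2: "CARD('a :: {field, finite}) \<ge> 2"
  using card_mono[of UNIV "{0, 1 :: 'a}"] by simp

lemma monic_irreducible_exists:
  assumes "n > 0"
  shows "\<exists>p :: 'a :: {field, finite} poly. monic p \<and> irreducible p \<and> degree p = n"
proof (rule ccontr)
  assume none: "\<not> ?thesis"
  let ?E = "prime_powers_of_degree :: nat \<Rightarrow> ('a poly \<times> nat) set"
  \<comment> \<open>Without irreducibles of degree \<open>n\<close>, each base \<open>p\<close> has
    smaller degree, so \<open>(p, 1)\<close> is counted in a lower degree.\<close>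
  have mem: "(p, 1) \<in> (\<Union>i\<in>{1..<n}. ?E i)" if "(p, k) \<in> ?E n" for p k
  proof -
    have p: "monic p" "irreducible p" "k * degree p = n" "k > 0"
      using that by (auto simp: prime_powers_of_degree_def prime_powers_def)
    then have "degree p \<le> n" "degree p > 0" by auto
    moreover have "degree p \<noteq> n" using none p by blast
    ultimately show ?thesis using p
      by (auto simp: prime_powers_of_degree_def prime_powers_def intro!: bexI[of _ "degree p"])
  qed
  \<comment> \<open>In \<open>?E n\<close> the base determines the exponent, because
    \<open>k * degree p = n\<close> with \<open>n\<close> positive.\<close>
  have inj: "inj_on (\<lambda>(p, k). (p, 1 :: nat)) (?E n)"
    using assms by (auto simp: inj_on_def prime_powers_of_degree_def)
  have "CARD('a) ^ n = (\<Sum>x\<in>?E n. degree (fst x))"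
    using sum_degree_prime_powers_of_degree[OF assms, where 'a = 'a] by (simp add: case_prod_unfold)
  also have "\<dots> = (\<Sum>x\<in>(\<lambda>(p, k). (p, 1 :: nat)) ` ?E n. degree (fst x))"
    by (subst sum.reindex[OF inj]) (simp add: case_prod_unfold)
  also have "\<dots> \<le> (\<Sum>x\<in>(\<Union>i\<in>{1..<n}. ?E i). degree (fst x))"
    using mem by (intro sum_mono2 finite_UN_I finite_prime_powers_of_degree) auto
  also have "\<dots> = (\<Sum>i=1..<n. \<Sum>x\<in>?E i. degree (fst x))"
    by (rule sum.UNION_disjoint)
       (auto simp: finite_prime_powers_of_degree disjoint_prime_powers_of_degree)
  also have "\<dots> = (\<Sum>i=1..<n. CARD('a) ^ i)"
    using sum_degree_prime_powers_of_degree[where 'a = 'a]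
    by (intro sum.cong) (auto simp: case_prod_unfold)
  also have "\<dots> < CARD('a) ^ n"
    by (rule sum_powers_less[OF card_field_ge_2 assms])
  finally show False by simp
qed

section \<open>Companion matrices\<close>

text \<open>For monic \<open>f\<close> of degree \<open>n\<close>, this is multiplication by the
  variable on the quotient ring modulo \<open>f\<close>, in the basis of powers, with images as
  columns.\<close>

definition companion_mat :: "nat \<Rightarrow> 'a :: comm_ring_1 poly \<Rightarrow> 'a mat" where
  "companion_mat n f =
     mat n n (\<lambda>(i, j). (if i = Suc j then 1 else 0) - (if Suc j = n then coeff f i else 0))"

lemma companion_mat_carrier [simp]: "companion_mat n f \<in> carrier_mat n n"
  by (simp add: companion_mat_def)

lemma dim_companion_mat [simp]:
  "dim_row (companion_mat n f) = n" "dim_col (companion_mat n f) = n"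
  by (simp_all add: companion_mat_def)

lemma mat_trace_companion_mat:
  assumes "n > 0"
  shows "mat_trace (companion_mat n f) = - coeff f (n - 1)"
proof -
  have "mat_trace (companion_mat n f) = (\<Sum>i<n. if i = n - 1 then - coeff f i else 0)"
    unfolding mat_trace_def by (rule sum.cong) (auto simp: companion_mat_def)
  then show ?thesis using assms by simp
qed

lemma dim_char_poly_matrix [simp]:
  "dim_row (char_poly_matrix A) = dim_row A" "dim_col (char_poly_matrix A) = dim_col A"
  by (simp_all add: char_poly_matrix_def)

lemma char_poly_matrix_companion_mat:
  assumes "i < n" "j < n"
  shows "char_poly_matrix (companion_mat n f) $$ (i, j) =
    (if i = j then [:0, 1:] else 0) - (if i = Suc j then 1 else 0)
    + (if Suc j = n then [:coeff f i:] else 0)"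
  using assms by (auto simp: char_poly_matrix_def companion_mat_def one_pCons)

text \<open>Expanding along the first row, the minor of the entry \<open>(0, 0)\<close> belongs to the companion matrix
  of \<open>f\<close>, while that of the last entry is upper triangular with \<open>-1\<close> on the diagonal.\<close>
lemma char_poly_companion_mat_pCons:
  fixes f :: "'a :: comm_ring_1 poly"
  assumes "n > 0"
  shows "char_poly (companion_mat (Suc n) (pCons a f)) =
    [:0, 1:] * char_poly (companion_mat n f) + [:a:]"
proof -
  let ?M = "char_poly_matrix (companion_mat (Suc n) (pCons a f))"
  have M: "?M \<in> carrier_mat (Suc n) (Suc n)" by simp
  have M0: "mat_delete ?M 0 0 = char_poly_matrix (companion_mat n f)"
    by (rule eq_matI) (auto simp: mat_delete_def char_poly_matrix_companion_mat)
  have ut: "upper_triangular (mat_delete ?M 0 n)"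
    by (auto simp: upper_triangular_def mat_delete_def char_poly_matrix_companion_mat)
  have diag: "diag_mat (mat_delete ?M 0 n) = replicate n (- 1)"
    by (auto simp: diag_mat_def mat_delete_def char_poly_matrix_companion_mat list_eq_iff_nth_eq)
  have Mn: "det (mat_delete ?M 0 n) = (- 1) ^ n"
    by (subst det_upper_triangular[OF ut, of n])
       (simp_all add: carrier_matI diag prod_list_replicate)
  have entry: "?M $$ (0, j) = (if j = 0 then [:0, 1:] else 0) + (if j = n then [:a:] else 0)"
    if "j < Suc n" for j
    using that by (simp add: char_poly_matrix_companion_mat)
  have row: "?M $$ (0, j) * cofactor ?M 0 j =
      (if j = 0 then [:0, 1:] * cofactor ?M 0 0 else 0)
      + (if j = n then [:a:] * cofactor ?M 0 n else 0)" if "j < Suc n" for j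
    unfolding entry[OF that] using assms by simp
  have "char_poly (companion_mat (Suc n) (pCons a f)) =
      (\<Sum>j<Suc n. (if j = 0 then [:0, 1:] * cofactor ?M 0 0 else 0)
        + (if j = n then [:a:] * cofactor ?M 0 n else 0))"
    unfolding char_poly_def laplace_expansion_row[OF M zero_less_Suc] using row
    by (intro sum.cong) auto
  also have "\<dots> = [:0, 1:] * cofactor ?M 0 0 + [:a:] * cofactor ?M 0 n"
    by (simp add: sum.distrib del: sum.lessThan_Suc)
  \<comment> \<open>The cofactor sign \<open>(- 1) ^ n\<close> cancels the determinant of the
    triangular minor.\<close>
  also have "cofactor ?M 0 n = 1"
    by (simp add: cofactor_def Mn minus_one_power_iff)
  also have "cofactor ?M 0 0 = char_poly (companion_mat n f)"
    by (simp add: cofactor_def M0 char_poly_def)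
  finally show ?thesis by simp
qed

text \<open>Horner's scheme: \<open>pCons a g\<close> is \<open>a\<close> plus the variable times
  \<open>g\<close>, and the characteristic polynomials obey the same recursion.\<close>

lemma char_poly_companion_mat:
  fixes f :: "'a :: comm_ring_1 poly"
  assumes "monic f" "degree f = n" "n > 0"
  shows "char_poly (companion_mat n f) = f"
  using assms(3,1,2)
proof (induction n arbitrary: f rule: nat_induct_non_zero)
  case 1
  then obtain a b where "f = [:a, b:]" by (elim degree1_coeffs)
  with 1 have f: "f = [:a, 1:]" by (auto split: if_splits)
  show ?case
    unfolding char_poly_def by (subst det_single) (auto intro: char_poly_matrix_closed simp: char_poly_matrix_companion_mat f)
next
  case (Suc n)
  obtain a g where f: "f = pCons a g" by (cases f)
  have "monic g" "degree g = n" using Suc.prems f by (auto split: if_splits)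
  then show ?case using Suc.IH[of g] Suc.hyps by (simp add: f char_poly_companion_mat_pCons)
qed

lemma ex_conj_class:
  fixes f :: "'a :: field poly"
  assumes "monic f" "degree f = n" "n > 0"
  shows "\<exists>X\<in>conj_classes n. class_char_poly X = f \<and> class_trace X = - coeff f (n - 1)"
proof -
  let ?C = "companion_mat n f"
  have X: "conj_class n ?C \<in> conj_classes n" by (simp add: conj_classes_def)
  have C: "?C \<in> conj_class n ?C"
    using similar_mat_refl[OF companion_mat_carrier, of n f]
    by (simp add: conj_class_eq_similar[OF companion_mat_carrier])
  show ?thesis
  proof (intro bexI[OF _ X] conjI)
    show "class_char_poly (conj_class n ?C) = f"
      unfolding class_char_poly_eq[OF X C] using assms by (rule char_poly_companion_mat)
    show "class_trace (conj_class n ?C) = - coeff f (n - 1)"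
      unfolding class_trace_eq[OF X C] using assms(3) by (rule mat_trace_companion_mat)
  qed
qed

section \<open>Two by two matrices\<close>

lemma char_poly_mat_2:
  fixes A :: "'a :: comm_ring_1 mat"
  assumes "A \<in> carrier_mat 2 2"
  shows "char_poly A = [:A $$ (0, 0) * A $$ (1, 1) - A $$ (0, 1) * A $$ (1, 0), - mat_trace A, 1:]"
proof -
  let ?M = "char_poly_matrix A"
  have M: "?M \<in> carrier_mat 2 2" using assms by simp
  have dimA: "dim_row A = 2" "dim_col A = 2" using assms by auto
  have two: "{..<2 :: nat} = {0, 1}" by auto
  have *: "det (mat_delete ?M 0 j) = mat_delete ?M 0 j $$ (0, 0)" for j
    by (rule det_single, rule carrier_matI) (simp_all add: dimA)
  have idx: "?M $$ (i, j) = (if i = j then [:0, 1:] else 0) - [:A $$ (i, j):]" if "i < 2" "j < 2" for i j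
    using that by (auto simp: char_poly_matrix_def dimA)
  have "char_poly A = (\<Sum>j<2. ?M $$ (0, j) * cofactor ?M 0 j)"
    unfolding char_poly_def by (rule laplace_expansion_row[OF M]) simp
  also have "\<dots> = [:A $$ (0, 0) * A $$ (1, 1) - A $$ (0, 1) * A $$ (1, 0), - mat_trace A, 1:]"
    unfolding mat_trace_def dimA two
    by (simp add: cofactor_def *) (simp add: mat_delete_def idx dimA algebra_simps)
  finally show ?thesis .
qed

text \<open>Serves the nonexistence claim, where the classes are arbitrary and the trace must be
  read off the characteristic polynomial.\<close>

lemma class_char_poly_2:
  assumes "X \<in> conj_classes 2"
  shows "\<exists>d. class_char_poly X = [:d, - class_trace X, 1:]"
proof -
  obtain A where A: "A \<in> carrier_mat 2 2" "X = conj_class 2 A"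
    using assms by (auto simp: conj_classes_def)
  have "A \<in> X" using A similar_mat_refl[OF A(1)] by (simp add: conj_class_eq_similar)
  then show ?thesis
    unfolding class_char_poly_eq[OF assms \<open>A \<in> X\<close>] class_trace_eq[OF assms \<open>A \<in> X\<close>]
      char_poly_mat_2[OF A(1)] by blast
qed

section \<open>Quadratic polynomials\<close>

text \<open>A proper factorization of a quadratic consists of two linear factors, and a linear
  factor over a field has a root.\<close>

lemma irreducible_quadratic_iff:
  fixes p :: "'a :: field poly"
  assumes "degree p = 2"
  shows "irreducible p \<longleftrightarrow> (\<forall>x. poly p x \<noteq> 0)"
proof
  assume irr: "irreducible p"
  show "\<forall>x. poly p x \<noteq> 0"
  proof (intro allI notI)
    fix x assume "poly p x = 0"
    then obtain r where r: "p = [:- x, 1:] * r" by (auto simp: poly_eq_0_iff_dvd)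
    have "degree r = 1" using assms unfolding r by (cases "r = 0") (simp_all add: degree_mult_eq del: mult_pCons_left)
    then show False using irr r irreducibleD[OF irr r] by auto
  qed
next
  assume noroot: "\<forall>x. poly p x \<noteq> 0"
  show "irreducible p"
  proof (rule irreducibleI)
    fix a b assume ab: "p = a * b"
    then have ne: "a \<noteq> 0" "b \<noteq> 0" using assms by auto
    have no1: "degree c \<noteq> 1" if "c dvd p" for c
    proof
      assume "degree c = 1"
      then obtain u v where "c = [:u, v:]" "v \<noteq> 0"
        by (elim degree1_coeffs)
      then have "poly c (- u / v) = 0" by simp
      then show False using that noroot by (auto elim!: dvdE)
    qed
    have "degree a + degree b = 2" using assms ab ne by (simp add: degree_mult_eq)
    moreover have "degree a \<noteq> 1" "degree b \<noteq> 1" using no1 ab by auto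
    ultimately have "degree a = 0 \<or> degree b = 0" by arith
    then show "is_unit a \<or> is_unit b" using ne by simp
  qed (use assms in auto)
qed

text \<open>The new polynomial has the old roots multiplied by \<open>u\<close>, so a root of it in
  the field would give one of the old.\<close>

lemma irreducible_quadratic_scale:
  fixes b c u :: "'a :: field"
  assumes "irreducible [:b, c, 1:]" "u \<noteq> 0"
  shows "irreducible [:u\<^sup>2 * b, u * c, 1:]"
proof -
  have "poly [:u\<^sup>2 * b, u * c, 1:] x = u\<^sup>2 * poly [:b, c, 1:] (x / u)" for x
    using assms(2) by (simp add: field_simps power2_eq_square)
  then show ?thesis using assms by (simp add: irreducible_quadratic_iff del: poly_pCons)
qed

text \<open>In characteristic two \<open>(x + y)\<^sup>2 = x\<^sup>2 + y\<^sup>2\<close>, so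
  squaring is injective, hence surjective on a finite field; and a square root of \<open>b\<close>
  is a root of the polynomial.\<close>

lemma pure_quadratic_char_2_root:
  fixes b :: "'a :: {field, finite}"
  assumes "(1 :: 'a) + 1 = 0"
  shows "\<exists>x. poly [:b, 0, 1:] x = 0"
proof -
  have two: "x + x = 0" for x :: 'a
    using assms by (metis distrib_left mult.right_neutral mult_zero_right)
  have "inj (\<lambda>x :: 'a. x * x)"
  proof (rule injI)
    fix x y :: 'a assume eq: "x * x = y * y"
    have "(x + y) * (x + y) = x * x + y * y + (x * y + x * y)" by (simp add: algebra_simps)
    also have "\<dots> = 0" unfolding eq two by simp
    finally have "x + y = 0" by simp
    also have "\<dots> = y + y" by (rule two[symmetric])
    finally show "x = y" by simp
  qed
  then have "surj (\<lambda>x :: 'a. x * x)" by (simp add: finite_UNIV_inj_surj)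
  then obtain x where "b = x * x" by (metis surjD)
  then show ?thesis using two by (auto intro!: exI[of _ x])
qed

section \<open>Traces of pairs of classes\<close>

definition admissible_pair :: "nat \<Rightarrow> 'a :: field poly \<Rightarrow> 'a poly \<Rightarrow> bool" where
  "admissible_pair n f g \<longleftrightarrow> irreducible f \<and> degree f = n \<and>
     (\<exists>l h. g = [:- l, 1:] * h \<and> irreducible h \<and> degree h = n - 1 \<and> poly h l \<noteq> 0)"

text \<open>Passes from polynomials to companion classes. The product of \<open>[:- l, 1:]\<close>
  and \<open>h\<close> has \<open>coeff h (n - 2) - l\<close> as its coefficient of degree
  \<open>n - 1\<close>, so its class has trace \<open>l - coeff h (n - 2)\<close>.\<close>

lemma ex_admissible_classes:
  fixes t l :: "'a :: field"
  assumes "n \<ge> 2"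
    and f: "monic f" "irreducible f" "degree f = n"
    and h: "monic h" "irreducible h" "degree h = n - 1" "poly h l \<noteq> 0"
    and t: "l - coeff f (n - 1) - coeff h (n - 2) = t"
  shows "\<exists>X\<in>conj_classes n. \<exists>Y\<in>conj_classes n.
    admissible_pair n (class_char_poly X) (class_char_poly Y) \<and> class_trace X + class_trace Y = t"
proof -
  let ?g = "[:- l, 1:] * h"
  have "h \<noteq> 0" using h(1) by auto
  then have "degree ?g = degree [:- l, 1:] + degree h" by (intro degree_mult_eq) auto
  also have "\<dots> = n" using assms(1) h(3) by simp
  finally have deg: "degree ?g = n" .
  have mon: "monic ?g" by (rule monic_mult) (use h(1) in auto)
  have "n - 1 = Suc (n - 2)" using assms(1) by simp
  then have "coeff ?g (n - 1) = coeff h (n - 2) - l"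
    using h(1,3) by simp
  obtain X where X: "X \<in> conj_classes n" "class_char_poly X = f"
      "class_trace X = - coeff f (n - 1)"
    using ex_conj_class[OF f(1,3)] assms(1) by auto
  obtain Y where Y: "Y \<in> conj_classes n" "class_char_poly Y = ?g"
      "class_trace Y = - coeff ?g (n - 1)"
    using ex_conj_class[OF mon deg] assms(1) by auto
  have "class_trace X + class_trace Y = t"
    unfolding X(3) Y(3) \<open>coeff ?g (n - 1) = _\<close> using t by (simp add: diff_diff_eq add.commute)
  moreover have "admissible_pair n (class_char_poly X) (class_char_poly Y)"
    unfolding admissible_pair_def X(2) Y(2) using f h by blast
  ultimately show ?thesis using X(1) Y(1) by blast
qed

lemma ex_irreducible_quadratic_trace_split:
  fixes t :: "'a :: {field, finite}"
  assumes "CARD('a) \<noteq> 2 \<or> t \<noteq> 1"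
  shows "\<exists>b c l m. irreducible [:b, c, 1:] \<and> l \<noteq> m \<and> l + m - c = t"
proof -
  \<comment> \<open>The choice \<open>m = t + c - l\<close> is forced, and it differs from
    \<open>l\<close> exactly when \<open>l + l \<noteq> t + c\<close>.\<close>
  have split: ?thesis if "irreducible [:b, c, 1:]" "l + l \<noteq> t + c" for b c l
    using that by (intro exI[of _ b] exI[of _ c] exI[of _ l] exI[of _ "t + c - l"])
      (auto simp: algebra_simps)
  obtain p :: "'a poly" where p: "monic p" "irreducible p" "degree p = 2"
    using monic_irreducible_exists[OF zero_less_numeral] by blast
  obtain a b c where abc: "p = [:b, c, a:]" using p(3) by (elim degree2_coeffs)
  then have "a = 1" using p(1,3) by (simp add: numeral_2_eq_2)
  then have irr: "irreducible [:b, c, 1:]" using p(2) abc by simp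
  show ?thesis
  proof (cases "\<exists>l. l + l \<noteq> t + c")
    case False
    \<comment> \<open>If every \<open>l\<close> fails, then \<open>0\<close> and \<open>1\<close>
      do, which gives characteristic two and \<open>t = - c\<close>.\<close>
    then have "0 + 0 = t + c" "1 + 1 = t + c" by blast+
    then have tc: "t + c = 0" and char2: "(1 :: 'a) + 1 = 0" by auto
    have "c \<noteq> 0"
      using irr pure_quadratic_char_2_root[OF char2, of b] by (auto simp: irreducible_quadratic_iff)
    have "\<exists>u :: 'a. u \<noteq> 0 \<and> u \<noteq> 1"
    proof (rule ccontr)
      assume "\<not> ?thesis"
      then have U: "(UNIV :: 'a set) = {0, 1}" by auto
      have "CARD('a) = 2" unfolding U by simp
      moreover have "c = 1" using U \<open>c \<noteq> 0\<close> by auto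
      then have "t = 1" using tc char2 by (metis add_right_cancel)
      ultimately show False using assms by blast
    qed
    then obtain u :: 'a where u: "u \<noteq> 0" "u \<noteq> 1" by blast
    have "u * c \<noteq> c" using u \<open>c \<noteq> 0\<close> by simp
    \<comment> \<open>After scaling by \<open>u\<close> the linear coefficient is
      \<open>u * c\<close>, no longer \<open>- t\<close>, so \<open>l = 0\<close> works.\<close>
    then have "0 + 0 \<noteq> t + u * c" using tc by (metis add.right_neutral add_left_cancel)
    with irreducible_quadratic_scale[OF irr u(1)] show ?thesis by (rule split)
  qed (use split[OF irr] in blast)
qed

lemma ex_admissible_classes_2:
  fixes t :: "'a :: {field, finite}"
  assumes "CARD('a) \<noteq> 2 \<or> t \<noteq> 1"
  shows "\<exists>X\<in>conj_classes 2. \<exists>Y\<in>conj_classes 2.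
    admissible_pair 2 (class_char_poly X) (class_char_poly Y) \<and> class_trace X + class_trace Y = t"
proof -
  obtain b c l m where "irreducible [:b, c, 1:]" "l \<noteq> m" "l + m - c = t"
    using ex_irreducible_quadratic_trace_split[OF assms] by blast
  then show ?thesis
    \<comment> \<open>With \<open>h = [:- m, 1:]\<close>, the value of \<open>h\<close> at
      \<open>l\<close> is \<open>l - m\<close>, nonzero because the two roots differ.\<close>
    by (intro ex_admissible_classes[of 2 "[:b, c, 1:]" "[:- m, 1:]" l])
       (auto simp: irreducible_linear_field_poly algebra_simps)
qed

lemma ex_admissible_classes_ge_3:
  fixes t :: "'a :: {field, finite}"
  assumes "n \<ge> 3"
  shows "\<exists>X\<in>conj_classes n. \<exists>Y\<in>conj_classes n.
    admissible_pair n (class_char_poly X) (class_char_poly Y) \<and> class_trace X + class_trace Y = t"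
proof -
  have "n > 0" "n - 1 > 0" using assms by auto
  obtain f :: "'a poly" where f: "monic f" "irreducible f" "degree f = n"
    using monic_irreducible_exists[OF \<open>n > 0\<close>] by blast
  obtain h :: "'a poly" where h: "monic h" "irreducible h" "degree h = n - 1"
    using monic_irreducible_exists[OF \<open>n - 1 > 0\<close>] by blast
  have "poly h x \<noteq> 0" for x
  proof
    assume "poly h x = 0"
    then obtain r where r: "h = [:- x, 1:] * r" by (auto simp: poly_eq_0_iff_dvd)
    then have "is_unit r" using irreducibleD[OF h(2) r] by auto
    then have "degree h = 1" unfolding r by (subst degree_mult_eq) auto
    then show False using h(3) assms by simp
  qed
  then show ?thesis
    using assms f h
    \<comment> \<open>The third argument is \<open>l\<close>, solved from the trace equation; any
      value is allowed since \<open>h\<close> has no root.\<close>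
    by (intro ex_admissible_classes[of n f h "t + coeff f (n - 1) + coeff h (n - 2)"]) auto
qed

text \<open>Over two elements an irreducible quadratic and a product of two distinct linear factors
  both have trace \<open>1\<close>, and \<open>1 + 1 = 0\<close>.\<close>

lemma no_admissible_classes_2_2:
  fixes X Y :: "'a :: {field, finite} mat set"
  assumes card: "CARD('a) = 2"
    and XY: "X \<in> conj_classes 2" "Y \<in> conj_classes 2"
    and adm: "admissible_pair 2 (class_char_poly X) (class_char_poly Y)"
  shows "class_trace X + class_trace Y \<noteq> 1"
proof -
  have "{0, 1} = (UNIV :: 'a set)"
    by (rule card_subset_eq) (use card in auto)
  then have two: "x = 0 \<or> x = 1" for x :: 'a by blast
  have char2: "(1 :: 'a) + 1 = 0" using two[of "1 + 1"] by (metis add_cancel_right_right zero_neq_one)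
  obtain d where d: "class_char_poly X = [:d, - class_trace X, 1:]"
    using class_char_poly_2[OF XY(1)] by blast
  then have "poly [:d, - class_trace X, 1:] x \<noteq> 0" for x
    using adm by (auto simp: admissible_pair_def irreducible_quadratic_iff)
  \<comment> \<open>Having no root at \<open>0\<close> forces \<open>d = 1\<close>; having none at
    \<open>1\<close> then forces trace \<open>1\<close>.\<close>
  from this[of 0] this[of 1] have "d \<noteq> 0" "d + 1 \<noteq> class_trace X" by (auto simp: add_diff_eq)
  then have X: "class_trace X = 1" using two char2 by metis
  obtain e where e: "class_char_poly Y = [:e, - class_trace Y, 1:]"
    using class_char_poly_2[OF XY(2)] by blast
  obtain l h where h: "class_char_poly Y = [:- l, 1:] * h" "degree h = 1" "poly h l \<noteq> 0"
    using adm by (auto simp: admissible_pair_def)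
  obtain a b where ab: "h = [:a, b:]" using h(2) by (elim degree1_coeffs)
  have "b = 1" "- class_trace Y = a - l" using h(1) by (auto simp: e ab)
  moreover from this have "a + l \<noteq> 0" using h(3) by (simp add: ab)
  \<comment> \<open>A zero trace would mean \<open>a = l\<close>, and then
    \<open>a + l = a + a = 0\<close>, against \<open>poly h l \<noteq> 0\<close>.\<close>
  moreover have "a + a = 0" using two[of a] char2 by auto
  ultimately have "class_trace Y \<noteq> 0" by auto
  then have "class_trace Y = 1" using two by blast
  then show ?thesis using X char2 by simp
qed

theorem lemma4p13:
  fixes n q :: nat and t :: "'a :: {field, finite}"
  assumes "n \<ge> 2" and "primepow q" and "card (UNIV :: 'a set) = q"
  shows "((q, n, t) \<noteq> (2, 2, 1) \<longrightarrow>
          (\<exists>X \<in> conj_classes n. \<exists>Y \<in> (conj_classes n :: 'a mat set set).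
             irreducible (class_char_poly X) \<and> degree (class_char_poly X) = n \<and>
             (\<exists>l h. class_char_poly Y = [:- l, 1:] * h \<and> irreducible h \<and> degree h = n - 1
                    \<and> poly h l \<noteq> 0) \<and>
             class_trace X + class_trace Y = t))
       \<and> ((q, n, t) = (2, 2, 1) \<longrightarrow>
          \<not> (\<exists>X \<in> conj_classes n. \<exists>Y \<in> (conj_classes n :: 'a mat set set).
             irreducible (class_char_poly X) \<and> degree (class_char_poly X) = n \<and>
             (\<exists>l h. class_char_poly Y = [:- l, 1:] * h \<and> irreducible h \<and> degree h = n - 1
                    \<and> poly h l \<noteq> 0) \<and>
             class_trace X + class_trace Y = t))"
proof (intro conjI impI)
  assume exc: "(q, n, t) \<noteq> (2, 2, 1)"
  have "\<exists>X\<in>conj_classes n. \<exists>Y\<in>conj_classes n.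
    admissible_pair n (class_char_poly X) (class_char_poly Y) \<and> class_trace X + class_trace Y = t"
  proof (cases "n = 2")
    case True
    then show ?thesis using ex_admissible_classes_2[of t] exc assms(3) by auto
  next
    case False
    then show ?thesis using ex_admissible_classes_ge_3[of n t] assms(1) by auto
  qed
  then show "\<exists>X\<in>conj_classes n. \<exists>Y\<in>conj_classes n.
      irreducible (class_char_poly X) \<and> degree (class_char_poly X) = n \<and>
      (\<exists>l h. class_char_poly Y = [:- l, 1:] * h \<and> irreducible h \<and> degree h = n - 1
             \<and> poly h l \<noteq> 0) \<and>
      class_trace X + class_trace Y = t"
    unfolding admissible_pair_def conj_assoc .
next
  assume "(q, n, t) = (2, 2, 1)"
  then have exc: "n = 2" "t = 1" "CARD('a) = 2" using assms(3) by auto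
  show "\<not> (\<exists>X\<in>conj_classes n. \<exists>Y\<in>conj_classes n.
      irreducible (class_char_poly X) \<and> degree (class_char_poly X) = n \<and>
      (\<exists>l h. class_char_poly Y = [:- l, 1:] * h \<and> irreducible h \<and> degree h = n - 1
             \<and> poly h l \<noteq> 0) \<and>
      class_trace X + class_trace Y = t)"
    using no_admissible_classes_2_2[OF exc(3)] unfolding exc admissible_pair_def by blast
qed

end
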